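(* Work in the single-channel setting of the context, with $\mathcal T$, $p_i$, $\omega_i$, $\phi_i$ and, for a threshold $\omega^*=\omega^*_\beta(m)$, the functions $L(\cdot,\omega^* )$, $\Omega,b_1,b_2,b_{3,i},f_i$ defined there. Let $n\ge 0$ be an integer, $\omega\in[0,1]$ a belief state and $m\in\mathbb R$. Consider the system of equations obtained by writing $$V_{\beta,m}(x)=b_1(x)m+b_2(x)\Omega(x)+\sum_{i=1}^K b_{3,i}(x)V_{\beta,m}(f_i(x))$$ for $x=\omega$, $x=f_{i_1}(\omega)$, $x=f_{i_2,i_1}(\omega)$, $\dots$, $x=f_{i_n,\dots,i_1}(\omega)$ (all $i_1,\dots,i_n\in\{1,\dots,K\}$), and set $V_{\beta,m}(f_{i_{n+1},\dots,i_1}(\omega))=0$ for all $i_1,\dots,i_{n+1}\in\{1,\dots,K\}$. Then the resulting $n$-iteration estimate $\widehat V_{\beta,m,n}(\omega)$ of $V_{\beta,m}(\omega)$ is $$\widehat V_{\beta,m,n}(\omega)=k_n(\omega)m+a_n(\omega),$$ where $k_0(\omega)=b_1(\omega)$, $a_0(\omega)=b_2(\omega)\Omega(\omega)$ and, for $n\ge1$, $$k_n(\omega)=k_0(\omega)+\sum_{i_1=1}^K b_{3,i_1}(\omega)\,k_{n-1}(f_{i_1}(\omega)),\qquad a_n(\omega)=a_0(\omega)+\sum_{i_1=1}^K b_{3,i_1}(\omega)\,a_{n-1}(f_{i_1}(\omega)).$$ Consequently, write $k_{n,0}=k_n(\mathcal T(\omega))$, $a_{n,0}=a_n(\mathcal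 T(\omega))$, $k_{n,i}=k_n(\omega_i)$, $a_{n,i}=a_n(\omega_i)$ for $i=1,\dots,K$, all evaluated with threshold $\omega^*_\beta(m)=\omega$. If $1+\beta\left(k_{n,0}-\sum_{i=1}^K p_i(\omega)k_{n,i}\right)\ne0$, then the $n$-iteration approximated Whittle index $\widehat W_n(\omega)$, i.e. the solution $m$ of $$\omega+\beta\sum_{i=1}^K p_i(\omega)\widehat V_{\beta,m,n}(\omega_i)=m+\beta \widehat V_{\beta,m,n}(\mathcal T(\omega))$$ with threshold $\omega^*_\beta(m)=\omega$, is $$\widehat W_n(\omega)=\left.\frac{\omega+\beta\left(\sum_{i=1}^K p_i(\omega)a_{n,i}-a_{n,0}\right)}{1+\beta\left(k_{n,0}-\sum_{i=1}^K p_i(\omega)k_{n,i}\right)}\right|_{\omega^*_\beta(m)=\omega}.$$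
   Context: Setting: $\beta\in(0,1)$; $p_{01},p_{11}\in(0,1)$ with $p_{01}\neq p_{11}$ are transition probabilities of a two-state Markov chain on $\{0,1\}$ ($p_{01}$: from $0$ to $1$; $p_{11}$: from $1$ to $1$); $K\ge1$; $(p_{i,1})_{i=1}^K$ and $(p_{i,0})_{i=1}^K$ are probability vectors. For a belief $\omega\in[0,1]$: $\mathcal T(\omega)=p_{11}\omega+p_{01}(1-\omega)$, $p_i(\omega)=p_{i,1}\omega+p_{i,0}(1-\omega)$, $\phi_i(\omega)=p_{i,1}\omega/p_i(\omega)$, $\omega_i=\mathcal T(\phi_i(\omega))$ (terms with $p_i(\omega)=0$ are read as $0$ in sums weighted by $p_i$). $\mathcal T^k$ is the $k$-fold iterate, $\mathcal T^0(\omega)=\omega$. For beliefs $\omega,\omega'$ the first crossing time is $L(\omega,\omega')=\min\{k\ge0:\mathcal T^k(\omega)>\omega'\}$, and $L(\omega,\omega')=+\infty$ if no such $k$ exists. Given a threshold $\omega^*=\omega^*_\beta(m)$ (regarded as a fixed number), with $L=L(\omega,\omega^* )$ define $$\Omega(\omega)=\mathcal T^{L}(\omega),\quad b_1(\omega)=\frac{1-\beta^{L}}{1-\beta},\quad b_2(\omega)=\beta^{L},\quad b_{3,i}(\omega)=\beta^{L+1}p_i\big(\mathcal T^{L}(\omega)\big),\quad f_i(\omega)=\mathcal T\big(\phi_i(\mathcal T^{L}(\omega))\big),$$ where for $L=+\infty$ one takes $\beta^L=0$, so that $b_1(\omega)=1/(1-\beta)$ and the terms containing $b_2(\omega)$ or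 $b_{3,i}(\omega)$ vanish. Compositions are written $f_{i_2,i_1}(\omega)=f_{i_2}(f_{i_1}(\omega))$, and similarly $f_{i_n,\dots,i_1}=f_{i_n}\circ\cdots\circ f_{i_1}$. Here $V_{\beta,m}$ denotes the value function of the single-armed bandit with subsidy $m$ for passivity (expected reward $\omega$ when active, $m$ when passive); in the truncated system of the claim its values at the listed points are treated as unknowns. *)

theory Defs
  imports Complex_Main "HOL-Library.Extended_Nat"
begin

text \<open>
  The single-channel model: discount factor, transition probabilities from 0 to 1 and from 1 to 1,
  number of observation outcomes, and the outcome probabilities
  (\<open>pr1 c i\<close> in state 1, \<open>pr0 c i\<close> in state 0), of which only the indices
  \<open>1, \<dots>, nobs c\<close> are relevant.
\<close>

record channel =
  disc :: real
  tp01 :: real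
  tp11 :: real
  nobs :: nat
  pr1 :: "nat \<Rightarrow> real"
  pr0 :: "nat \<Rightarrow> real"

definition prob_vector :: "nat \<Rightarrow> (nat \<Rightarrow> real) \<Rightarrow> bool" where
  "prob_vector K q \<longleftrightarrow> (\<forall>i\<in>{1..K}. 0 \<le> q i) \<and> (\<Sum>i=1..K. q i) = 1"

definition valid_channel :: "channel \<Rightarrow> bool" where
  "valid_channel c \<longleftrightarrow>
     0 < disc c \<and> disc c < 1 \<and>
     0 < tp01 c \<and> tp01 c < 1 \<and> 0 < tp11 c \<and> tp11 c < 1 \<and> tp01 c \<noteq> tp11 c \<and>
     1 \<le> nobs c \<and> prob_vector (nobs c) (pr1 c) \<and> prob_vector (nobs c) (pr0 c)"

definition trans_belief :: "channel \<Rightarrow> real \<Rightarrow> real" where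
  "trans_belief c \<omega> = tp11 c * \<omega> + tp01 c * (1 - \<omega>)"

definition obs_prob :: "channel \<Rightarrow> nat \<Rightarrow> real \<Rightarrow> real" where
  "obs_prob c i \<omega> = pr1 c i * \<omega> + pr0 c i * (1 - \<omega>)"

text \<open>
  If \<open>obs_prob c i \<omega> = 0\<close>, then the posterior below is the meaningless value 0 (division by 0);
  it is used only in terms with the factor \<open>obs_prob c i \<omega>\<close>, which are then 0.
\<close>

definition posterior :: "channel \<Rightarrow> nat \<Rightarrow> real \<Rightarrow> real" where
  "posterior c i \<omega> = pr1 c i * \<omega> / obs_prob c i \<omega>"

definition next_belief :: "channel \<Rightarrow> nat \<Rightarrow> real \<Rightarrow> real" where
  "next_belief c i \<omega> = trans_belief c (posterior c i \<omega>)"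

definition crossing_time :: "channel \<Rightarrow> real \<Rightarrow> real \<Rightarrow> enat" where
  "crossing_time c \<omega> \<omega>' =
     (if \<exists>k. (trans_belief c ^^ k) \<omega> > \<omega>'
      then enat (LEAST k. (trans_belief c ^^ k) \<omega> > \<omega>')
      else \<infinity>)"

fun disc_power :: "real \<Rightarrow> enat \<Rightarrow> real" where
  "disc_power \<beta> (enat k) = \<beta> ^ k"
| "disc_power \<beta> \<infinity> = 0"

text \<open>
  In the following definitions \<open>\<theta>\<close> is the threshold. For an infinite crossing time the
  belief at crossing does not exist; the value \<open>\<omega>\<close> chosen for it is irrelevant, because
  \<open>coef_b2\<close> and \<open>coef_b3\<close> are then 0.
\<close>

definition crossing_belief :: "channel \<Rightarrow> real \<Rightarrow> real \<Rightarrow> real" where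
  "crossing_belief c \<theta> \<omega> =
     (case crossing_time c \<omega> \<theta> of enat k \<Rightarrow> (trans_belief c ^^ k) \<omega> | \<infinity> \<Rightarrow> \<omega>)"

definition coef_b1 :: "channel \<Rightarrow> real \<Rightarrow> real \<Rightarrow> real" where
  "coef_b1 c \<theta> \<omega> = (1 - disc_power (disc c) (crossing_time c \<omega> \<theta>)) / (1 - disc c)"

definition coef_b2 :: "channel \<Rightarrow> real \<Rightarrow> real \<Rightarrow> real" where
  "coef_b2 c \<theta> \<omega> = disc_power (disc c) (crossing_time c \<omega> \<theta>)"

definition coef_b3 :: "channel \<Rightarrow> real \<Rightarrow> nat \<Rightarrow> real \<Rightarrow> real" where
  "coef_b3 c \<theta> i \<omega> =
     disc_power (disc c) (crossing_time c \<omega> \<theta> + 1) * obs_prob c i (crossing_belief c \<theta> \<omega>)"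

definition next_point :: "channel \<Rightarrow> real \<Rightarrow> nat \<Rightarrow> real \<Rightarrow> real" where
  "next_point c \<theta> i \<omega> = trans_belief c (posterior c i (crossing_belief c \<theta> \<omega>))"

text \<open>
  The word \<open>[i\<^sub>j, \<dots>, i\<^sub>1]\<close> stands for the composition of the \<open>next_point\<close> maps
  in which \<open>i\<^sub>1\<close> is applied first.
\<close>

definition point_at :: "channel \<Rightarrow> real \<Rightarrow> real \<Rightarrow> nat list \<Rightarrow> real" where
  "point_at c \<theta> \<omega> s = foldr (next_point c \<theta>) s \<omega>"

text \<open>
  The unknowns \<open>v s\<close> of the truncated system are indexed by words and not by belief values:
  points reached by different words may coincide, and identifying a point of level \<open>n + 1\<close>
  (value set to 0) with one of an earlier level could make the system inconsistent.
\<close>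

definition truncated_system ::
  "channel \<Rightarrow> real \<Rightarrow> real \<Rightarrow> nat \<Rightarrow> real \<Rightarrow> (nat list \<Rightarrow> real) \<Rightarrow> bool" where
  "truncated_system c \<theta> m n \<omega> v \<longleftrightarrow>
     (\<forall>s. set s \<subseteq> {1..nobs c} \<and> length s \<le> n \<longrightarrow>
        v s = coef_b1 c \<theta> (point_at c \<theta> \<omega> s) * m
            + coef_b2 c \<theta> (point_at c \<theta> \<omega> s) * crossing_belief c \<theta> (point_at c \<theta> \<omega> s)
            + (\<Sum>i=1..nobs c. coef_b3 c \<theta> i (point_at c \<theta> \<omega> s) * v (i # s))) \<and>
     (\<forall>s. set s \<subseteq> {1..nobs c} \<and> length s = n + 1 \<longrightarrow> v s = 0)"

definition value_estimate :: "channel \<Rightarrow> real \<Rightarrow> real \<Rightarrow> nat \<Rightarrow> real \<Rightarrow> real" where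
  "value_estimate c \<theta> m n \<omega> = (THE y. \<exists>v. truncated_system c \<theta> m n \<omega> v \<and> y = v [])"

primrec coef_k :: "channel \<Rightarrow> real \<Rightarrow> nat \<Rightarrow> real \<Rightarrow> real" where
  "coef_k c \<theta> 0 \<omega> = coef_b1 c \<theta> \<omega>"
| "coef_k c \<theta> (Suc n) \<omega> =
     coef_b1 c \<theta> \<omega> + (\<Sum>i=1..nobs c. coef_b3 c \<theta> i \<omega> * coef_k c \<theta> n (next_point c \<theta> i \<omega>))"

primrec coef_a :: "channel \<Rightarrow> real \<Rightarrow> nat \<Rightarrow> real \<Rightarrow> real" where
  "coef_a c \<theta> 0 \<omega> = coef_b2 c \<theta> \<omega> * crossing_belief c \<theta> \<omega>"
| "coef_a c \<theta> (Suc n) \<omega> =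
     coef_b2 c \<theta> \<omega> * crossing_belief c \<theta> \<omega>
     + (\<Sum>i=1..nobs c. coef_b3 c \<theta> i \<omega> * coef_a c \<theta> n (next_point c \<theta> i \<omega>))"

text \<open>The threshold is fixed to \<open>\<omega>\<close> itself, independently of the candidate subsidy \<open>m\<close>.\<close>

definition whittle_equation :: "channel \<Rightarrow> nat \<Rightarrow> real \<Rightarrow> real \<Rightarrow> bool" where
  "whittle_equation c n \<omega> m \<longleftrightarrow>
     \<omega> + disc c * (\<Sum>i=1..nobs c. obs_prob c i \<omega> * value_estimate c \<omega> m n (next_belief c i \<omega>))
     = m + disc c * value_estimate c \<omega> m n (trans_belief c \<omega>)"

definition whittle_approx :: "channel \<Rightarrow> nat \<Rightarrow> real \<Rightarrow> real" where
  "whittle_approx c n \<omega> = (THE m. whittle_equation c n \<omega> m)"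

end

theory Submission
  imports Defs
begin

text \<open>
  The truncated system is triangular in the length of the words: the equation for a word of
  length \<open>l\<close> involves only words of length \<open>l + 1\<close>, and the unknowns of length
  \<open>n + 1\<close> are zero. Back substitution from the longest words therefore determines all
  unknowns. An unknown at a word of length \<open>l\<close> is reached after \<open>n - l\<close> substitution
  steps, so its value depends only on its belief point and on the number \<open>n - l\<close> of
  iterations that remain. As every equation is affine in the subsidy \<open>m\<close>, so is this value,
  and collecting the slope and the constant term separately reproduces the recursions of
  \<open>coef_k\<close> and \<open>coef_a\<close>
  (\<open>affine_value_Suc\<close>, \<open>truncated_system_affine\<close>, \<open>truncated_system_unique\<close>).

  Since the threshold in the indifference equation is held at \<open>\<omega>\<close>, the coefficients there do
  not depend on \<open>m\<close>. Inserting the affine values turns it into a linear equation in the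
  single unknown \<open>m\<close>, with the stated denominator as its leading coefficient.
\<close>

definition affine_value :: "channel \<Rightarrow> real \<Rightarrow> real \<Rightarrow> nat \<Rightarrow> real \<Rightarrow> real" where
  "affine_value c \<theta> m j x = coef_k c \<theta> j x * m + coef_a c \<theta> j x"

lemma affine_value_0:
  "affine_value c \<theta> m 0 x = coef_b1 c \<theta> x * m + coef_b2 c \<theta> x * crossing_belief c \<theta> x"
  by (simp add: affine_value_def)

text \<open>
  This is the one-step equation of the system, with one iteration fewer left at each successor
  point: the recursions of \<open>coef_k\<close> and \<open>coef_a\<close> carry the same weights, so they
  combine into a single recursion for the affine value.
\<close>

lemma affine_value_Suc:
  "affine_value c \<theta> m (Suc j) x =
     coef_b1 c \<theta> x * m + coef_b2 c \<theta> x * crossing_belief c \<theta> x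
     + (\<Sum>i=1..nobs c. coef_b3 c \<theta> i x * affine_value c \<theta> m j (next_point c \<theta> i x))"
  by (simp add: affine_value_def algebra_simps sum.distrib sum_distrib_left)

lemma point_at_Nil [simp]: "point_at c \<theta> \<omega> [] = \<omega>"
  by (simp add: point_at_def)

lemma point_at_Cons [simp]:
  "point_at c \<theta> \<omega> (i # s) = next_point c \<theta> i (point_at c \<theta> \<omega> s)"
  by (simp add: point_at_def)

text \<open>
  Existence: the values that back substitution yields, extended by zero to the words beyond the
  truncation level, satisfy every equation.
\<close>

lemma truncated_system_affine:
  "truncated_system c \<theta> m n \<omega>
     (\<lambda>s. if length s \<le> n then affine_value c \<theta> m (n - length s) (point_at c \<theta> \<omega> s) else 0)"
  (is "truncated_system c \<theta> m n \<omega> ?v")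
proof -
  have "?v s = coef_b1 c \<theta> (point_at c \<theta> \<omega> s) * m
      + coef_b2 c \<theta> (point_at c \<theta> \<omega> s) * crossing_belief c \<theta> (point_at c \<theta> \<omega> s)
      + (\<Sum>i=1..nobs c. coef_b3 c \<theta> i (point_at c \<theta> \<omega> s) * ?v (i # s))"
    if le: "length s \<le> n" for s
  proof (cases "length s = n")
    case True
    then show ?thesis by (simp add: affine_value_0)
  next
    case False
    with le have "n - length s = Suc (n - Suc (length s))" "Suc (length s) \<le> n" by auto
    then show ?thesis using le by (simp add: affine_value_Suc)
  qed
  then show ?thesis unfolding truncated_system_def by simp
qed

text \<open>
  Uniqueness, by induction on the number of iterations that remain, that is, from the longest
  words down to the empty one. Only words over the outcomes \<open>1, \<dots>, nobs c\<close> are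
  constrained by the system, and prepending an outcome stays within them.
\<close>

lemma truncated_system_unique:
  assumes sys: "truncated_system c \<theta> m n \<omega> v"
    and "set s \<subseteq> {1..nobs c}" and "length s + j = n"
  shows "v s = affine_value c \<theta> m j (point_at c \<theta> \<omega> s)"
  using assms(2,3)
proof (induction j arbitrary: s)
  case 0
  have "v (i # s) = 0" if "i \<in> {1..nobs c}" for i
    using sys 0 that unfolding truncated_system_def by simp
  moreover have "v s = coef_b1 c \<theta> (point_at c \<theta> \<omega> s) * m
      + coef_b2 c \<theta> (point_at c \<theta> \<omega> s) * crossing_belief c \<theta> (point_at c \<theta> \<omega> s)
      + (\<Sum>i=1..nobs c. coef_b3 c \<theta> i (point_at c \<theta> \<omega> s) * v (i # s))"
    using sys 0 unfolding truncated_system_def by simp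
  ultimately show ?case by (simp add: affine_value_0)
next
  case (Suc j)
  have "v (i # s) = affine_value c \<theta> m j (next_point c \<theta> i (point_at c \<theta> \<omega> s))"
    if "i \<in> {1..nobs c}" for i
    using Suc.IH[of "i # s"] Suc.prems that by simp
  moreover have "v s = coef_b1 c \<theta> (point_at c \<theta> \<omega> s) * m
      + coef_b2 c \<theta> (point_at c \<theta> \<omega> s) * crossing_belief c \<theta> (point_at c \<theta> \<omega> s)
      + (\<Sum>i=1..nobs c. coef_b3 c \<theta> i (point_at c \<theta> \<omega> s) * v (i # s))"
    using sys Suc.prems unfolding truncated_system_def by simp
  ultimately show ?case by (simp add: affine_value_Suc)
qed

lemma truncated_system_Nil:
  "truncated_system c \<theta> m n \<omega> v \<Longrightarrow> v [] = affine_value c \<theta> m n \<omega>"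
  using truncated_system_unique[of c \<theta> m n \<omega> v "[]" n] by simp

lemma value_estimate_eq: "value_estimate c \<theta> m n \<omega> = affine_value c \<theta> m n \<omega>"
  unfolding value_estimate_def
proof (rule the_equality)
  show "\<exists>v. truncated_system c \<theta> m n \<omega> v \<and> affine_value c \<theta> m n \<omega> = v []"
    using truncated_system_affine truncated_system_Nil by metis
qed (auto dest: truncated_system_Nil)

text \<open>
  The indifference equation between the active and the passive action is linear in the subsidy;
  the right-hand side below is the estimated advantage of the active action at subsidy zero.
\<close>

lemma whittle_equation_linear:
  "whittle_equation c n \<omega> m \<longleftrightarrow>
     (1 + disc c * (coef_k c \<omega> n (trans_belief c \<omega>)
        - (\<Sum>i=1..nobs c. obs_prob c i \<omega> * coef_k c \<omega> n (next_belief c i \<omega>)))) * m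
     = \<omega> + disc c * ((\<Sum>i=1..nobs c. obs_prob c i \<omega> * coef_a c \<omega> n (next_belief c i \<omega>))
        - coef_a c \<omega> n (trans_belief c \<omega>))"
proof -
  have "(\<Sum>i=1..nobs c. obs_prob c i \<omega> * affine_value c \<omega> m n (next_belief c i \<omega>))
    = (\<Sum>i=1..nobs c. obs_prob c i \<omega> * coef_k c \<omega> n (next_belief c i \<omega>)) * m
      + (\<Sum>i=1..nobs c. obs_prob c i \<omega> * coef_a c \<omega> n (next_belief c i \<omega>))"
    by (simp add: affine_value_def algebra_simps sum.distrib sum_distrib_left)
  then show ?thesis
    unfolding whittle_equation_def value_estimate_eq affine_value_def
    by (auto simp: algebra_simps)
qed

theorem theorem4:
  fixes c :: channel and n :: nat and \<omega> m \<theta> :: real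
  assumes "valid_channel c" and "0 \<le> \<omega>" and "\<omega> \<le> 1"
  shows "(\<exists>v. truncated_system c \<theta> m n \<omega> v) \<and>
    (\<forall>v. truncated_system c \<theta> m n \<omega> v \<longrightarrow> v [] = value_estimate c \<theta> m n \<omega>) \<and>
    value_estimate c \<theta> m n \<omega> = coef_k c \<theta> n \<omega> * m + coef_a c \<theta> n \<omega> \<and>
    (1 + disc c * (coef_k c \<omega> n (trans_belief c \<omega>)
        - (\<Sum>i=1..nobs c. obs_prob c i \<omega> * coef_k c \<omega> n (next_belief c i \<omega>))) \<noteq> 0 \<longrightarrow>
      (\<forall>x. whittle_equation c n \<omega> x \<longleftrightarrow> x = whittle_approx c n \<omega>) \<and>
      whittle_approx c n \<omega> =
        (\<omega> + disc c * ((\<Sum>i=1..nobs c. obs_prob c i \<omega> * coef_a c \<omega> n (next_belief c i \<omega>))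
            - coef_a c \<omega> n (trans_belief c \<omega>)))
        / (1 + disc c * (coef_k c \<omega> n (trans_belief c \<omega>)
            - (\<Sum>i=1..nobs c. obs_prob c i \<omega> * coef_k c \<omega> n (next_belief c i \<omega>)))))"
proof -
  have system: "(\<exists>v. truncated_system c \<theta> m n \<omega> v) \<and>
    (\<forall>v. truncated_system c \<theta> m n \<omega> v \<longrightarrow> v [] = value_estimate c \<theta> m n \<omega>) \<and>
    value_estimate c \<theta> m n \<omega> = coef_k c \<theta> n \<omega> * m + coef_a c \<theta> n \<omega>"
    using truncated_system_affine[of c \<theta> m n \<omega>] truncated_system_Nil[of c \<theta> m n \<omega>]
    unfolding value_estimate_eq affine_value_def[symmetric] by blast
  let ?D = "1 + disc c * (coef_k c \<omega> n (trans_belief c \<omega>)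
      - (\<Sum>i=1..nobs c. obs_prob c i \<omega> * coef_k c \<omega> n (next_belief c i \<omega>)))"
  let ?N = "\<omega> + disc c * ((\<Sum>i=1..nobs c. obs_prob c i \<omega> * coef_a c \<omega> n (next_belief c i \<omega>))
      - coef_a c \<omega> n (trans_belief c \<omega>))"
  have "(\<forall>x. whittle_equation c n \<omega> x \<longleftrightarrow> x = whittle_approx c n \<omega>)
      \<and> whittle_approx c n \<omega> = ?N / ?D" if D: "?D \<noteq> 0"
  proof -
    have sol: "whittle_equation c n \<omega> x \<longleftrightarrow> x = ?N / ?D" for x
      unfolding whittle_equation_linear eq_divide_eq using D by (simp add: mult.commute)
    then have "whittle_approx c n \<omega> = ?N / ?D"
      unfolding whittle_approx_def by (intro the_equality) blast+
    with sol show ?thesis by simp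
  qed
  with system show ?thesis by blast
qed

end
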